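(* For a $T_0$ space $X$, the following conditions are equivalent: (1) $X$ is well-filtered. (2) $\mathsf{RD}(X)=\mathcal S_c(X)$. (3) $\mathsf{WD}(X)=\mathcal S_c(X)$, that is, for each $A\in\mathsf{WD}(X)$ there exists a unique $x\in X$ such that $A=\overline{\{x\}}$. (4) $X$ is homeomorphic to $X^w$.
   Context: For a $T_0$ space $X$, the specialization order is $x\le y$ iff $x\in\overline{\{y\}}$, and $\mathcal S_c(X)=\{\overline{\{x\}}:x\in X\}$. $\mathsf{K}(X)$ is the set of nonempty compact saturated subsets (saturated = upper set in the specialization order). A family $\mathcal K\subseteq \mathsf K(X)$ is filtered if it is nonempty and for all $K_1,K_2\in\mathcal K$ there is $K_3\in\mathcal K$ with $K_3\subseteq K_1\cap K_2$. A space $Y$ is well-filtered if it is $T_0$ and for every open $U\subseteq Y$ and every filtered family $\mathcal K\subseteq\mathsf K(Y)$, $\bigcap\mathcal K\subseteq U$ implies $K\subseteq U$ for some $K\in\mathcal K$. $\mathsf{RD}(X)$ is the set of nonempty closed subsets $A$ of $X$ for which there is a filtered family $\mathcal K\subseteq\mathsf K(X)$ such that $A$ is minimal (under inclusion) among the closed subsets of $X$ that meet every member of $\mathcal K$. $\mathsf{WD}(X)$ is the set of closed subsets $A$ of $X$ such that for every continuous map $f:X\to Y$ to a well-filtered space $Y$ there is a unique $y_A\in Y$ with $\overline{f(A)}=\overline{\{y_A\}}$. $X^w$ denotes the well-filtered reflection of $X$, realized as the set $\mathsf{WD}(X)$ with the topology generated by the sets $\Diamond U=\{A\in\mathsf{WD}(X):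 A\cap U\ne\emptyset\}$, $U$ open in $X$. *)

theory Defs
  imports "HOL-Analysis.Analysis"
begin

(* False unless both points lie in topspace X. *)
definition spec_le :: "'a topology \<Rightarrow> 'a \<Rightarrow> 'a \<Rightarrow> bool" where
  "spec_le X x y \<longleftrightarrow> x \<in> X closure_of {y}"

definition saturatedin :: "'a topology \<Rightarrow> 'a set \<Rightarrow> bool" where
  "saturatedin X S \<longleftrightarrow> S \<subseteq> topspace X \<and> (\<forall>x\<in>S. \<forall>y. spec_le X x y \<longrightarrow> y \<in> S)"

definition point_closures :: "'a topology \<Rightarrow> 'a set set" where
  "point_closures X = {X closure_of {x} |x. x \<in> topspace X}"

definition compact_saturated_sets :: "'a topology \<Rightarrow> 'a set set" where
  "compact_saturated_sets X = {K. K \<noteq> {} \<and> compactin X K \<and> saturatedin X K}"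

definition filtered_family :: "'a set set \<Rightarrow> bool" where
  "filtered_family \<K> \<longleftrightarrow>
     \<K> \<noteq> {} \<and> (\<forall>K1\<in>\<K>. \<forall>K2\<in>\<K>. \<exists>K3\<in>\<K>. K3 \<subseteq> K1 \<inter> K2)"

definition well_filtered_space :: "'a topology \<Rightarrow> bool" where
  "well_filtered_space Y \<longleftrightarrow> t0_space Y \<and>
     (\<forall>U \<K>. openin Y U \<and> filtered_family \<K> \<and> \<K> \<subseteq> compact_saturated_sets Y \<and> \<Inter>\<K> \<subseteq> U
        \<longrightarrow> (\<exists>K\<in>\<K>. K \<subseteq> U))"

definition closed_meeting :: "'a topology \<Rightarrow> 'a set set \<Rightarrow> 'a set set" where
  "closed_meeting X \<K> = {C. closedin X C \<and> (\<forall>K\<in>\<K>. C \<inter> K \<noteq> {})}"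

definition RD :: "'a topology \<Rightarrow> 'a set set" where
  "RD X = {A. A \<noteq> {} \<and> closedin X A \<and>
     (\<exists>\<K>. filtered_family \<K> \<and> \<K> \<subseteq> compact_saturated_sets X \<and>
        A \<in> closed_meeting X \<K> \<and> (\<forall>B\<in>closed_meeting X \<K>. B \<subseteq> A \<longrightarrow> B = A))}"

(* WD(X) ranges over all well-filtered spaces Y.  HOL cannot quantify over types inside a
   definition, so Y ranges over the spaces whose points are taken from 'a set.  This is no
   restriction: lemma WD_universal below shows that every A in WD X satisfies the condition
   for well-filtered spaces Y over an arbitrary type. *)
definition WD :: "'a topology \<Rightarrow> 'a set set" where
  "WD X = {A. closedin X A \<and>
     (\<forall>(Y :: 'a set topology) f. well_filtered_space Y \<and> continuous_map X Y f \<longrightarrow>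
        (\<exists>!y. y \<in> topspace Y \<and> Y closure_of (f ` A) = Y closure_of {y}))}"

definition WD_diamond :: "'a topology \<Rightarrow> 'a set \<Rightarrow> 'a set set" where
  "WD_diamond X U = {A \<in> WD X. A \<inter> U \<noteq> {}}"

definition wf_reflection :: "'a topology \<Rightarrow> 'a set topology" where
  "wf_reflection X = topology_generated_by {WD_diamond X U |U. openin X U}"


subsection \<open>The point set of the reflection is all of \<open>WD X\<close>\<close>

lemma compact_saturated_setsD:
  assumes "K \<in> compact_saturated_sets X"
  shows "K \<noteq> {}" "compactin X K" "K \<subseteq> topspace X"
    "\<And>x y. x \<in> K \<Longrightarrow> x \<in> X closure_of {y} \<Longrightarrow> y \<in> K"
  using assms by (auto simp: compact_saturated_sets_def saturatedin_def spec_le_def)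

lemma empty_notin_WD: "{} \<notin> WD X"
proof
  assume e: "{} \<in> WD X"
  let ?Y = "discrete_topology {{}} :: 'a set topology"
  have wfY: "well_filtered_space ?Y"
    unfolding well_filtered_space_def
  proof (intro conjI allI impI)
    fix U :: "'a set set" and \<K>
    assume h: "openin ?Y U \<and> filtered_family \<K> \<and> \<K> \<subseteq> compact_saturated_sets ?Y \<and> \<Inter>\<K> \<subseteq> U"
    have s: "K = {{}}" if "K \<in> \<K>" for K
    proof -
      have "K \<in> compact_saturated_sets ?Y" using h that by blast
      from compact_saturated_setsD(1,3)[OF this] show ?thesis by auto
    qed
    obtain K where K: "K \<in> \<K>" using h unfolding filtered_family_def by auto
    have "\<K> = {K}" using s K by blast
    then show "\<exists>K\<in>\<K>. K \<subseteq> U" using h by auto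
  qed (simp add: t0_space_discrete_topology)
  have ex: "\<exists>!y. y \<in> topspace Y \<and> Y closure_of (f ` {}) = Y closure_of {y}"
    if "well_filtered_space Y" "continuous_map X Y f" for Y :: "'a set topology" and f
    using e that by (simp only: WD_def mem_Collect_eq)
  obtain y where "?Y closure_of ((\<lambda>_. {}) ` {}) = ?Y closure_of {y}" "y \<in> topspace ?Y"
    using ex1_implies_ex[OF ex[of ?Y "\<lambda>_. {}", OF wfY]] by auto
  then show False by (auto simp: discrete_topology_closure_of)
qed

lemma topspace_wf_reflection: "topspace (wf_reflection X) = WD X"
proof -
  have "WD_diamond X (topspace X) = WD X"
  proof -
    have "A \<inter> topspace X \<noteq> {}" if A: "A \<in> WD X" for A
    proof -
      have "A \<noteq> {}" using A empty_notin_WD by metis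
      moreover have "A \<subseteq> topspace X" using A by (auto simp: WD_def dest: closedin_subset)
      ultimately show ?thesis by auto
    qed
    then show ?thesis by (auto simp: WD_diamond_def)
  qed
  moreover have "WD_diamond X U \<subseteq> WD X" for U
    by (auto simp: WD_diamond_def)
  ultimately show ?thesis
    unfolding wf_reflection_def topology_generated_by_topspace by blast
qed


subsection \<open>The choice of the type in \<open>WD\<close> is immaterial\<close>

lemma maximal_open_avoiding_compacts:
  assumes V: "openin Y V" and cpt: "\<And>K. K \<in> \<K> \<Longrightarrow> compactin Y K"
    and av: "\<And>K. K \<in> \<K> \<Longrightarrow> \<not> K \<subseteq> V"
  shows "\<exists>M. openin Y M \<and> V \<subseteq> M \<and> (\<forall>K\<in>\<K>. \<not> K \<subseteq> M) \<and>
    (\<forall>N. openin Y N \<and> M \<subseteq> N \<and> (\<forall>K\<in>\<K>. \<not> K \<subseteq> N) \<longrightarrow> N = M)"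
proof -
  define \<A> where "\<A> = {U. openin Y U \<and> V \<subseteq> U \<and> (\<forall>K\<in>\<K>. \<not> K \<subseteq> U)}"
  have "\<exists>M\<in>\<A>. \<forall>N\<in>\<A>. M \<subseteq> N \<longrightarrow> N = M"
  proof (rule subset_Zorn_nonempty)
    show "\<A> \<noteq> {}" using V av unfolding \<A>_def by auto
  next
    fix \<C> assume ne: "\<C> \<noteq> {}" and ch: "subset.chain \<A> \<C>"
    have CA: "\<C> \<subseteq> \<A>" using ch by (auto simp: subset.chain_def)
    have "\<not> K \<subseteq> \<Union>\<C>" if K: "K \<in> \<K>" for K
    proof
      assume "K \<subseteq> \<Union>\<C>"
      moreover have "\<forall>U\<in>\<C>. openin Y U" using CA unfolding \<A>_def by auto
      ultimately obtain \<F> where F: "finite \<F>" "\<F> \<subseteq> \<C>" "K \<subseteq> \<Union>\<F>"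
        using cpt[OF K] unfolding compactin_def by meson
      have "\<F> \<noteq> {}" using F(3) av[OF K] by auto
      moreover have "subset.chain \<A> \<F>"
        using ch F(2) unfolding subset.chain_def by blast
      ultimately have "\<Union>\<F> \<in> \<F>" using Union_in_chain F(1) by metis
      then show False using F CA K unfolding \<A>_def by auto
    qed
    moreover have "openin Y (\<Union>\<C>)" using CA unfolding \<A>_def by (intro openin_Union) auto
    moreover have "V \<subseteq> \<Union>\<C>" using ne CA unfolding \<A>_def by blast
    ultimately show "\<Union>\<C> \<in> \<A>" unfolding \<A>_def by auto
  qed
  then obtain M where M: "M \<in> \<A>" and mx: "\<And>N. N \<in> \<A> \<Longrightarrow> M \<subseteq> N \<Longrightarrow> N = M" by blast
  have "N = M" if "openin Y N" "M \<subseteq> N" "\<forall>K\<in>\<K>. \<not> K \<subseteq> N" for N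
    using that M by (intro mx) (auto simp: \<A>_def)
  then show ?thesis using M unfolding \<A>_def by blast
qed

lemma in_closure_of_sing_trans:
  "x \<in> Y closure_of {y} \<Longrightarrow> y \<in> Y closure_of {z} \<Longrightarrow> x \<in> Y closure_of {z}"
  by (auto simp: in_closure_of)

definition upset_of :: "'a topology \<Rightarrow> 'a set \<Rightarrow> 'a set" where
  "upset_of Y K = {y \<in> topspace Y. \<exists>x\<in>K. x \<in> Y closure_of {y}}"

lemma subset_upset_of: "K \<subseteq> topspace Y \<Longrightarrow> K \<subseteq> upset_of Y K"
  by (force simp: upset_of_def in_closure_of)

lemma upset_of_subset_open: "openin Y U \<Longrightarrow> K \<subseteq> U \<Longrightarrow> upset_of Y K \<subseteq> U"
  by (auto simp: upset_of_def in_closure_of)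

lemma upset_of_compact_saturated:
  assumes "compactin Y K" "K \<noteq> {}"
  shows "upset_of Y K \<in> compact_saturated_sets Y"
proof -
  have sub: "K \<subseteq> upset_of Y K" by (simp add: assms(1) compactin_subset_topspace subset_upset_of)
  have "compactin Y (upset_of Y K)"
    unfolding compactin_def
  proof (intro conjI allI impI)
    fix \<U> assume U: "(\<forall>U\<in>\<U>. openin Y U) \<and> upset_of Y K \<subseteq> \<Union>\<U>"
    then obtain \<F> where F: "finite \<F>" "\<F> \<subseteq> \<U>" "K \<subseteq> \<Union>\<F>"
      using assms(1) sub unfolding compactin_def by (meson order_trans)
    have "openin Y (\<Union>\<F>)" using U F by (intro openin_Union) auto
    then show "\<exists>\<F>. finite \<F> \<and> \<F> \<subseteq> \<U> \<and> upset_of Y K \<subseteq> \<Union>\<F>"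
      using upset_of_subset_open[OF _ F(3)] F by blast
  qed (auto simp: upset_of_def)
  moreover have "saturatedin Y (upset_of Y K)"
    unfolding saturatedin_def spec_le_def
  proof (intro conjI ballI allI impI)
    fix x y assume "x \<in> upset_of Y K" and xy: "x \<in> Y closure_of {y}"
    then obtain k where k: "k \<in> K" "k \<in> Y closure_of {x}" by (auto simp: upset_of_def)
    have "y \<in> topspace Y" using xy by (auto simp: in_closure_of)
    then show "y \<in> upset_of Y K"
      using k in_closure_of_sing_trans[OF k(2) xy] by (auto simp: upset_of_def)
  qed (auto simp: upset_of_def)
  ultimately show ?thesis using assms(2) sub by (auto simp: compact_saturated_sets_def)
qed

lemma well_filtered_pullback:
  fixes Y :: "'b topology" and h :: "'c \<Rightarrow> 'b"
  assumes wf: "well_filtered_space Y" and inj: "inj_on h S" and hS: "h ` S \<subseteq> topspace Y"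
    and skula: "\<And>y. y \<in> topspace Y \<Longrightarrow>
        Y closure_of (Y closure_of {y} \<inter> h ` S) = Y closure_of {y} \<Longrightarrow> y \<in> h ` S"
  shows "well_filtered_space (pullback_topology S h Y)" (is "well_filtered_space ?W")
proof -
  have t0: "t0_space Y" using wf by (simp add: well_filtered_space_def)
  have top: "topspace ?W = S" using hS by (auto simp: topspace_pullback_topology)
  have le: "s \<in> ?W closure_of {t} \<longleftrightarrow> s \<in> S \<and> t \<in> S \<and> h s \<in> Y closure_of {h t}" for s t
  proof
    assume "s \<in> ?W closure_of {t}"
    then have s: "s \<in> S" and all: "\<And>T. openin ?W T \<Longrightarrow> s \<in> T \<Longrightarrow> t \<in> T"
      by (auto simp: in_closure_of top)
    have t: "t \<in> S" using all[of S] s openin_topspace[of ?W] top by simp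
    have "h t \<in> U" if "openin Y U" "h s \<in> U" for U
    proof -
      have "openin ?W (h -` U \<inter> S)" using that by (auto simp: openin_pullback_topology)
      from all[OF this] show ?thesis using that s by auto
    qed
    then show "s \<in> S \<and> t \<in> S \<and> h s \<in> Y closure_of {h t}"
      using s t hS by (auto simp: in_closure_of)
  next
    assume "s \<in> S \<and> t \<in> S \<and> h s \<in> Y closure_of {h t}"
    then show "s \<in> ?W closure_of {t}"
      by (auto simp: in_closure_of top openin_pullback_topology)
  qed
  show ?thesis
    unfolding well_filtered_space_def
  proof (intro conjI allI impI)
    show "t0_space ?W"
      unfolding t0_space_def
    proof (intro ballI impI)
      fix x y assume xy: "x \<in> topspace ?W" "y \<in> topspace ?W" "x \<noteq> y"
      then have "h x \<noteq> h y" "h x \<in> topspace Y" "h y \<in> topspace Y"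
        using inj hS by (auto simp: top inj_on_def)
      then obtain U where U: "openin Y U" "h x \<notin> U \<longleftrightarrow> h y \<in> U"
        using t0 unfolding t0_space_def by metis
      have "openin ?W (h -` U \<inter> S)" using U by (auto simp: openin_pullback_topology)
      moreover have "x \<notin> h -` U \<inter> S \<longleftrightarrow> y \<in> h -` U \<inter> S" using U xy top by auto
      ultimately show "\<exists>U. openin ?W U \<and> (x \<notin> U \<longleftrightarrow> y \<in> U)" by blast
    qed
  next
    fix U \<K>
    assume "openin ?W U \<and> filtered_family \<K> \<and> \<K> \<subseteq> compact_saturated_sets ?W \<and> \<Inter>\<K> \<subseteq> U"
    then have oU: "openin ?W U" and fil: "filtered_family \<K>"
      and KK: "\<K> \<subseteq> compact_saturated_sets ?W" and int: "\<Inter>\<K> \<subseteq> U" by auto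
    obtain V where V: "openin Y V" and UV: "U = h -` V \<inter> S"
      using oU by (auto simp: openin_pullback_topology)
    have KS: "K \<subseteq> S" if "K \<in> \<K>" for K
      using compact_saturated_setsD(3)[of K ?W] that KK top by auto
    have hcont: "continuous_map ?W Y h"
      using continuous_map_pullback[OF continuous_map_id, of S h Y] by simp
    have cpt: "compactin Y (h ` K)" if "K \<in> \<K>" for K
    proof (rule image_compactin[OF _ hcont])
      show "compactin ?W K"
        by (rule compact_saturated_setsD(2)) (use that KK in auto)
    qed
    show "\<exists>K\<in>\<K>. K \<subseteq> U"
    proof (rule ccontr)
      assume no: "\<not> (\<exists>K\<in>\<K>. K \<subseteq> U)"
      have "\<not> h ` K \<subseteq> V" if "K \<in> \<K>" for K
      proof
        assume "h ` K \<subseteq> V"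
        then have "K \<subseteq> U" using KS[OF that] by (auto simp: UV)
        then show False using no that by blast
      qed
      then have av: "\<not> H \<subseteq> V" if "H \<in> (`) h ` \<K>" for H using that by blast
      have cptH: "compactin Y H" if "H \<in> (`) h ` \<K>" for H using that cpt by blast
      have "\<exists>M. openin Y M \<and> V \<subseteq> M \<and> (\<forall>H\<in>(`) h ` \<K>. \<not> H \<subseteq> M) \<and>
        (\<forall>N. openin Y N \<and> M \<subseteq> N \<and> (\<forall>H\<in>(`) h ` \<K>. \<not> H \<subseteq> N) \<longrightarrow> N = M)"
        by (rule maximal_open_avoiding_compacts[OF V]) (fact cptH, fact av)
      then obtain M
        where M: "openin Y M" "V \<subseteq> M" and Mav': "\<forall>H\<in>(`) h ` \<K>. \<not> H \<subseteq> M"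
          and mx': "\<forall>N. openin Y N \<and> M \<subseteq> N \<and> (\<forall>H\<in>(`) h ` \<K>. \<not> H \<subseteq> N) \<longrightarrow> N = M"
        by (elim exE conjE) (rule that)
      have Mav: "\<not> h ` K \<subseteq> M" if "K \<in> \<K>" for K using Mav' that by blast
      have mx: "N = M" if "openin Y N" "M \<subseteq> N" "\<And>K. K \<in> \<K> \<Longrightarrow> \<not> h ` K \<subseteq> N" for N
      proof -
        have "\<forall>H\<in>(`) h ` \<K>. \<not> H \<subseteq> N" using that(3) by blast
        then show ?thesis using mx' that(1,2) by blast
      qed
      define \<L> where "\<L> = (\<lambda>K. upset_of Y (h ` K)) ` \<K>"
      have Lcs: "\<L> \<subseteq> compact_saturated_sets Y"
      proof -
        have "upset_of Y (h ` K) \<in> compact_saturated_sets Y" if "K \<in> \<K>" for K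
        proof (rule upset_of_compact_saturated)
          show "h ` K \<noteq> {}" using compact_saturated_setsD(1)[of K ?W] that KK by auto
        qed (rule cpt[OF that])
        then show ?thesis by (auto simp: \<L>_def)
      qed
      have "upset_of Y (h ` K) \<subseteq> upset_of Y (h ` K')" if "K \<subseteq> K'" for K K'
        using that by (auto simp: upset_of_def)
      then have Lf: "filtered_family \<L>"
        using fil unfolding filtered_family_def \<L>_def by simp (metis Int_subset_iff)
      have "\<not> L \<subseteq> M" if L: "L \<in> \<L>" for L
      proof -
        obtain K where K: "K \<in> \<K>" "L = upset_of Y (h ` K)" using L by (auto simp: \<L>_def)
        have "h ` K \<subseteq> topspace Y" using KS[OF K(1)] hS by auto
        then show ?thesis using Mav[OF K(1)] K(2) subset_upset_of by (metis order_trans)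
      qed
      then have "\<not> \<Inter>\<L> \<subseteq> M"
        using wf Lcs Lf M(1) unfolding well_filtered_space_def by blast
      then obtain y where y: "\<And>L. L \<in> \<L> \<Longrightarrow> y \<in> L" "y \<notin> M" by blast
      have yK: "\<exists>k\<in>K. h k \<in> Y closure_of {y}" if "K \<in> \<K>" for K
        using y(1)[of "upset_of Y (h ` K)"] that by (auto simp: \<L>_def upset_of_def)
      obtain L where "L \<in> \<L>" using Lf unfolding filtered_family_def by auto
      then have yY: "y \<in> topspace Y" using y(1) by (auto simp: \<L>_def upset_of_def)
      let ?c = "Y closure_of {y}"
      have "topspace Y - ?c = M"
      proof (rule mx)
        show "M \<subseteq> topspace Y - ?c"
          using M(1) y(2) openin_subset[OF M(1)] by (auto simp: in_closure_of)
        show "\<not> h ` K \<subseteq> topspace Y - ?c" if "K \<in> \<K>" for K using yK[OF that] by blast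
      qed (simp add: openin_diff)
      then have Mc: "M = topspace Y - ?c" ..
      let ?d = "Y closure_of (?c \<inter> h ` S)"
      have dc: "?d \<subseteq> ?c" by (simp add: closure_of_minimal)
      have sd: "?c \<inter> h ` S \<subseteq> ?d" using hS by (intro closure_of_subset) auto
      have "topspace Y - ?d = M"
      proof (rule mx)
        show "M \<subseteq> topspace Y - ?d" using dc Mc by auto
        show "\<not> h ` K \<subseteq> topspace Y - ?d" if "K \<in> \<K>" for K
          using yK[OF that] KS[OF that] sd by blast
      qed (simp add: openin_diff)
      then have "?d = ?c"
        using Mc closure_of_subset_topspace[of Y "{y}"] closure_of_subset_topspace[of Y "?c \<inter> h ` S"]
        by blast
      then obtain s where s: "s \<in> S" "y = h s" using skula[OF yY] by blast
      have "s \<in> K" if K: "K \<in> \<K>" for K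
      proof -
        obtain k where "k \<in> K" "h k \<in> ?c" using yK[OF K] by blast
        then have "k \<in> ?W closure_of {s}" using le s KS[OF K] by auto
        then show ?thesis using compact_saturated_setsD(4)[of K ?W k s] K KK \<open>k \<in> K\<close> by blast
      qed
      then have "s \<in> U" using int by blast
      then show False using UV s M(2) y(2) by auto
    qed
  qed
qed

lemma WD_universal:
  fixes X :: "'a topology" and Y :: "'b topology"
  assumes A: "A \<in> WD X" and wf: "well_filtered_space Y" and f: "continuous_map X Y f"
  shows "\<exists>!y. y \<in> topspace Y \<and> Y closure_of (f ` A) = Y closure_of {y}"
proof -
  have t0: "t0_space Y" using wf by (simp add: well_filtered_space_def)
  have fX: "x \<in> topspace X \<Longrightarrow> f x \<in> topspace Y" for x
    using f by (auto simp: continuous_map_def)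
  have clinj: "y = z" if "y \<in> topspace Y" "z \<in> topspace Y" "Y closure_of {y} = Y closure_of {z}"
    for y z using t0 that unfolding t0_space_closure_of_sing by blast
  have self: "y \<in> Y closure_of {y}" if "y \<in> topspace Y" for y
    using that by (simp add: in_closure_of)
  define p where "p y = {x \<in> topspace X. f x \<in> Y closure_of {y}}" for y
  define Z where "Z = {y \<in> topspace Y. Y closure_of (f ` p y) = Y closure_of {y}}"
  define S where "S = p ` Z"
  define h where "h = inv_into Z p"
  have injp: "inj_on p Z" using clinj by (auto simp: inj_on_def Z_def)
  have hp: "h (p y) = y" if "y \<in> Z" for y using injp that by (simp add: h_def)
  have hSZ: "h ` S = Z" using hp by (auto simp: S_def image_iff)
  have injh: "inj_on h S" using hp by (auto simp: inj_on_def S_def)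
  have ZY: "Z \<subseteq> topspace Y" by (auto simp: Z_def)
  have ple: "f ` p y \<subseteq> Y closure_of {y}" for y by (auto simp: p_def)
  let ?W = "pullback_topology S h Y"
  have wfW: "well_filtered_space ?W"
  proof (rule well_filtered_pullback[OF wf injh])
    show "h ` S \<subseteq> topspace Y" using hSZ ZY by simp
    fix y assume y: "y \<in> topspace Y"
      and eq: "Y closure_of (Y closure_of {y} \<inter> h ` S) = Y closure_of {y}"
    have "z \<in> Y closure_of (f ` p y)" if z: "z \<in> Z" "z \<in> Y closure_of {y}" for z
    proof -
      have "p z \<subseteq> p y" using in_closure_of_sing_trans z(2) by (fastforce simp: p_def)
      then have "Y closure_of (f ` p z) \<subseteq> Y closure_of (f ` p y)"
        by (intro closure_of_mono image_mono)
      then show ?thesis using z self unfolding Z_def by auto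
    qed
    then have "Y closure_of {y} \<subseteq> Y closure_of (f ` p y)"
      using eq closure_of_minimal[of "Y closure_of {y} \<inter> h ` S" "Y closure_of (f ` p y)" Y] hSZ
      by auto
    moreover have "Y closure_of (f ` p y) \<subseteq> Y closure_of {y}"
      by (simp add: closure_of_minimal ple)
    ultimately show "y \<in> h ` S" using y hSZ by (auto simp: Z_def)
  qed
  have fZ: "f x \<in> Z" if x: "x \<in> topspace X" for x
  proof -
    have "{f x} \<subseteq> f ` p (f x)" using x self[OF fX[OF x]] by (auto simp: p_def)
    then have "Y closure_of {f x} \<subseteq> Y closure_of (f ` p (f x))" by (rule closure_of_mono)
    moreover have "Y closure_of (f ` p (f x)) \<subseteq> Y closure_of {f x}"
      by (simp add: closure_of_minimal ple)
    ultimately show ?thesis using fX[OF x] by (auto simp: Z_def)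
  qed
  define g where "g x = p (f x)" for x
  have hg: "h (g x) = f x" if "x \<in> topspace X" for x using fZ[OF that] hp by (simp add: g_def)
  have topW: "topspace ?W = S" using hSZ ZY by (auto simp: topspace_pullback_topology)
  have "continuous_map X ?W g"
  proof (rule continuous_map_pullback')
    show "continuous_map X Y (h \<circ> g)" using f by (rule continuous_map_eq) (simp add: hg)
    show "topspace X \<subseteq> g -` S" using fZ by (auto simp: g_def S_def)
  qed
  then obtain s where s: "s \<in> S" and eq: "?W closure_of (g ` A) = ?W closure_of {s}"
    using A wfW topW unfolding WD_def by blast
  have AX: "A \<subseteq> topspace X" using A by (auto simp: WD_def dest: closedin_subset)
  have gA: "g ` A \<subseteq> S" using AX fZ by (auto simp: g_def S_def)
  have hsY: "h s \<in> topspace Y" using s hSZ ZY by auto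
  have fA: "f ` A \<subseteq> topspace Y" using AX fX by auto
  have iff: "f ` A \<subseteq> D \<longleftrightarrow> h s \<in> D" if D: "closedin Y D" for D
  proof -
    have "openin ?W (h -` (topspace Y - D) \<inter> S)"
      using D by (auto simp: openin_pullback_topology)
    moreover have "topspace ?W - (h -` D \<inter> S) = h -` (topspace Y - D) \<inter> S"
      using hSZ ZY by (auto simp: topW)
    ultimately have E: "closedin ?W (h -` D \<inter> S)" by (simp add: closedin_def topW)
    have "f x = h (g x)" if "x \<in> A" for x using that AX hg by auto
    then have "f ` A \<subseteq> D \<longleftrightarrow> g ` A \<subseteq> h -` D \<inter> S" using gA by (auto simp: image_subset_iff)
    also have "\<dots> \<longleftrightarrow> ?W closure_of (g ` A) \<subseteq> h -` D \<inter> S"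
      using E gA topW by (intro closure_of_minimal_eq[symmetric]) auto
    also have "\<dots> \<longleftrightarrow> {s} \<subseteq> h -` D \<inter> S"
      unfolding eq using E s topW by (intro closure_of_minimal_eq) auto
    finally show ?thesis using s by auto
  qed
  have ex: "Y closure_of (f ` A) = Y closure_of {h s}"
  proof (rule subset_antisym)
    show "Y closure_of (f ` A) \<subseteq> Y closure_of {h s}"
      using iff[of "Y closure_of {h s}"] self[OF hsY] by (simp add: closure_of_minimal)
    show "Y closure_of {h s} \<subseteq> Y closure_of (f ` A)"
      using iff[of "Y closure_of (f ` A)"] closure_of_subset[OF fA] by (simp add: closure_of_minimal)
  qed
  show ?thesis
  proof (rule ex1I)
    show "h s \<in> topspace Y \<and> Y closure_of (f ` A) = Y closure_of {h s}" using hsY ex ..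
    show "y = h s" if "y \<in> topspace Y \<and> Y closure_of (f ` A) = Y closure_of {y}" for y
      using that ex by (intro clinj hsY) auto
  qed
qed

end

theory Submission
  imports Defs
begin

text \<open>
  Every \<open>A\<close> in \<open>RD X\<close> lies in \<open>WD X\<close>: if \<open>A\<close> is minimal among the closed sets meeting all
  \<open>K \<in> \<K>\<close> and \<open>f\<close> maps into a well-filtered space, then the saturations of the sets
  \<open>f(K \<inter> A)\<close> have a common point \<open>y\<close> in the closure of \<open>f(A)\<close>, and minimality forces
  \<open>f(A)\<close> into the closure of \<open>y\<close>.  Conversely, a failure of well-filteredness yields, by Zorn's
  lemma, a member of \<open>RD X\<close> that is not a point closure.  Applied to \<open>wf_reflection X\<close>, this
  criterion shows that the reflection is well-filtered: the closure of the union of a member of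
  \<open>RD (wf_reflection X)\<close> belongs to \<open>WD X\<close>, because every map from \<open>X\<close> to a well-filtered space
  extends continuously to \<open>wf_reflection X\<close>.
\<close>

section \<open>Rudin sets between point closures and \<open>WD\<close>\<close>

lemma t0_space_closure_of_sing_inj:
  "t0_space Y \<Longrightarrow> y \<in> topspace Y \<Longrightarrow> z \<in> topspace Y \<Longrightarrow> Y closure_of {y} = Y closure_of {z} \<Longrightarrow> y = z"
  unfolding t0_space_closure_of_sing by blast

lemma in_closure_of_self: "y \<in> topspace Y \<Longrightarrow> y \<in> Y closure_of {y}"
  by (simp add: in_closure_of)

lemma closure_of_sing_subset: "closedin Y C \<Longrightarrow> y \<in> C \<Longrightarrow> Y closure_of {y} \<subseteq> C"
  by (simp add: closure_of_minimal)

text \<open>The target may have any point type, so that later the source can be the reflection and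
  the target any homeomorphic copy of it. Uniqueness of \<open>y\<close> follows from T0 where it is
  needed.\<close>

lemma RD_image_closure:
  assumes A: "A \<in> RD X" and wf: "well_filtered_space Y" and f: "continuous_map X Y f"
  shows "\<exists>y\<in>topspace Y. Y closure_of (f ` A) = Y closure_of {y}"
proof -
  obtain \<K> where cA: "closedin X A" and fil: "filtered_family \<K>"
    and KK: "\<K> \<subseteq> compact_saturated_sets X" and AK: "\<And>K. K \<in> \<K> \<Longrightarrow> A \<inter> K \<noteq> {}"
    and mn: "\<And>B. B \<in> closed_meeting X \<K> \<Longrightarrow> B \<subseteq> A \<Longrightarrow> B = A"
    using A by (auto simp: RD_def closed_meeting_def)
  have AX: "A \<subseteq> topspace X" using cA by (rule closedin_subset)
  have fA: "f ` A \<subseteq> topspace Y" using AX f by (auto simp: continuous_map_def)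
  define L where "L K = upset_of Y (f ` (A \<inter> K))" for K
  have L_mono: "L K \<subseteq> L K'" if "K \<subseteq> K'" for K K'
    using that by (auto simp: L_def upset_of_def)
  have "compactin Y (f ` (A \<inter> K))" if "K \<in> \<K>" for K
    using that KK cA f
    by (intro image_compactin[OF _ f] closed_Int_compactin) (auto dest: compact_saturated_setsD(2))
  then have Lcs: "L ` \<K> \<subseteq> compact_saturated_sets Y"
    unfolding L_def using AK by (auto intro!: upset_of_compact_saturated)
  have Lfil: "filtered_family (L ` \<K>)"
    using fil L_mono unfolding filtered_family_def by simp (metis Int_subset_iff)
  have "\<not> \<Inter>(L ` \<K>) \<subseteq> topspace Y - Y closure_of (f ` A)"
  proof
    assume "\<Inter>(L ` \<K>) \<subseteq> topspace Y - Y closure_of (f ` A)"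
    moreover have "openin Y (topspace Y - Y closure_of (f ` A))" by (simp add: openin_diff)
    ultimately have "\<exists>M\<in>L ` \<K>. M \<subseteq> topspace Y - Y closure_of (f ` A)"
      using wf Lcs Lfil unfolding well_filtered_space_def by blast
    then obtain K where K: "K \<in> \<K>" "L K \<subseteq> topspace Y - Y closure_of (f ` A)" by blast
    have "f ` (A \<inter> K) \<subseteq> L K" unfolding L_def using fA by (intro subset_upset_of) auto
    moreover have "f ` (A \<inter> K) \<subseteq> Y closure_of (f ` A)" using closure_of_subset[OF fA] by auto
    ultimately show False using K AK by blast
  qed
  moreover have "\<Inter>(L ` \<K>) \<subseteq> topspace Y"
    using fil by (auto simp: filtered_family_def L_def upset_of_def)
  ultimately obtain y where y: "y \<in> topspace Y" "y \<in> Y closure_of (f ` A)" "\<And>K. K \<in> \<K> \<Longrightarrow> y \<in> L K"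
    by blast
  \<comment> \<open>The part of \<open>A\<close> that is mapped below \<open>y\<close>. It meets
    every \<open>K\<close>, because \<open>y \<in> L K\<close> says that some point of
    \<open>A \<inter> K\<close> is sent below \<open>y\<close>.\<close>
  let ?B = "{x \<in> topspace X. f x \<in> Y closure_of {y}} \<inter> A"
  have "?B = A"
  proof (rule mn)
    have "?B \<inter> K \<noteq> {}" if "K \<in> \<K>" for K
      using y(3)[OF that] AX by (auto simp: L_def upset_of_def)
    moreover have "closedin X ?B"
      using f cA by (intro closedin_Int closedin_continuous_map_preimage[OF f]) auto
    ultimately show "?B \<in> closed_meeting X \<K>" by (simp add: closed_meeting_def)
  qed auto
  then have "f ` A \<subseteq> Y closure_of {y}" by blast
  then have "Y closure_of (f ` A) = Y closure_of {y}"
    using y(2) by (simp add: closure_of_minimal subset_antisym)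
  then show ?thesis using y(1) by blast
qed

lemma RD_subset_WD: "RD X \<subseteq> WD X"
proof
  fix A assume A: "A \<in> RD X"
  have "\<exists>!y. y \<in> topspace Y \<and> Y closure_of (f ` A) = Y closure_of {y}"
    if "well_filtered_space Y" "continuous_map X Y f" for Y :: "'a set topology" and f
    using RD_image_closure[OF A that] t0_space_closure_of_sing_inj[of Y] that(1)
    unfolding well_filtered_space_def by metis
  then show "A \<in> WD X" using A by (auto simp: WD_def RD_def)
qed

text \<open>A closed set meets the principal upper set of \<open>x\<close> exactly if it contains
  \<open>x\<close>. Hence the family consisting of this one compact saturated set has the closure of
  \<open>x\<close> as its least closed set meeting all members.\<close>

lemma point_closures_subset_RD: "point_closures X \<subseteq> RD X"
proof
  fix A assume "A \<in> point_closures X"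
  then obtain x where x: "x \<in> topspace X" and A: "A = X closure_of {x}"
    by (auto simp: point_closures_def)
  let ?K = "upset_of X {x}"
  have K: "?K \<in> compact_saturated_sets X"
    using x by (intro upset_of_compact_saturated) auto
  have meet: "C \<inter> ?K \<noteq> {} \<longleftrightarrow> x \<in> C" if C: "closedin X C" for C
    using closure_of_sing_subset[OF C] x in_closure_of_self[OF x]
    by (auto simp: upset_of_def)
  have "B = A" if B: "B \<in> closed_meeting X {?K}" "B \<subseteq> A" for B
    using B meet[of B] closure_of_sing_subset[of X B x] by (auto simp: closed_meeting_def A)
  moreover have "A \<in> closed_meeting X {?K}"
    using meet[of A] in_closure_of_self[OF x] by (auto simp: closed_meeting_def A)
  moreover have "filtered_family {?K}" by (simp add: filtered_family_def)
  moreover have "A \<noteq> {}" "closedin X A" using in_closure_of_self[OF x] by (auto simp: A)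
  ultimately show "A \<in> RD X" using K unfolding RD_def by blast
qed

lemma well_filtered_if_RD_subset:
  assumes t0: "t0_space X" and RD: "RD X \<subseteq> point_closures X"
  shows "well_filtered_space X"
  unfolding well_filtered_space_def
proof (intro conjI allI impI t0)
  fix U \<K>
  assume "openin X U \<and> filtered_family \<K> \<and> \<K> \<subseteq> compact_saturated_sets X \<and> \<Inter>\<K> \<subseteq> U"
  then have U: "openin X U" and fil: "filtered_family \<K>"
    and KK: "\<K> \<subseteq> compact_saturated_sets X" and int: "\<Inter>\<K> \<subseteq> U" by auto
  show "\<exists>K\<in>\<K>. K \<subseteq> U"
  proof (rule ccontr)
    assume no: "\<not> (\<exists>K\<in>\<K>. K \<subseteq> U)"
    have cpt: "compactin X K" "K \<subseteq> topspace X" if "K \<in> \<K>" for K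
      using that KK by (auto dest: compact_saturated_setsD)
    \<comment> \<open>Complements of open sets containing no member of \<open>\<K>\<close> are the
      closed sets meeting every member, so maximality of \<open>M\<close> is minimality of its
      complement.\<close>
    have "\<exists>M. openin X M \<and> U \<subseteq> M \<and> (\<forall>K\<in>\<K>. \<not> K \<subseteq> M) \<and>
        (\<forall>N. openin X N \<and> M \<subseteq> N \<and> (\<forall>K\<in>\<K>. \<not> K \<subseteq> N) \<longrightarrow> N = M)"
      using no by (intro maximal_open_avoiding_compacts U cpt) auto
    then obtain M where M: "openin X M" "U \<subseteq> M" and av: "\<forall>K\<in>\<K>. \<not> K \<subseteq> M"
      and mx: "\<forall>N. openin X N \<and> M \<subseteq> N \<and> (\<forall>K\<in>\<K>. \<not> K \<subseteq> N) \<longrightarrow> N = M"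
      by (elim exE conjE) (rule that)
    let ?A = "topspace X - M"
    have cA: "closedin X ?A" using M(1) by blast
    have meet: "?A \<in> closed_meeting X \<K>"
      using av cpt(2) cA unfolding closed_meeting_def by blast
    have "B = ?A" if B: "B \<in> closed_meeting X \<K>" "B \<subseteq> ?A" for B
    proof -
      have cB: "closedin X B" using B(1) by (simp add: closed_meeting_def)
      have "topspace X - B = M"
      proof (rule mx[rule_format], intro conjI)
        show "openin X (topspace X - B)" using cB by blast
        show "M \<subseteq> topspace X - B" using B(2) openin_subset[OF M(1)] by blast
        show "\<forall>K\<in>\<K>. \<not> K \<subseteq> topspace X - B" using B(1) unfolding closed_meeting_def by blast
      qed
      then show ?thesis using closedin_subset[OF cB] by blast
    qed
    moreover have "?A \<noteq> {}"
    proof -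
      obtain K where "K \<in> \<K>" using fil by (auto simp: filtered_family_def)
      then show ?thesis using meet unfolding closed_meeting_def by blast
    qed
    ultimately have "?A \<in> RD X" using fil KK cA meet unfolding RD_def by blast
    then obtain x where x: "x \<in> topspace X" "?A = X closure_of {x}"
      using RD by (auto simp: point_closures_def)
    \<comment> \<open>\<open>K\<close> contains a point below \<open>x\<close> and is
      saturated.\<close>
    have "x \<in> K" if K: "K \<in> \<K>" for K
    proof -
      obtain k where "k \<in> K" "k \<in> X closure_of {x}"
        using meet K x(2) unfolding closed_meeting_def by blast
      then show ?thesis using compact_saturated_setsD(4)[of K X k x] K KK by blast
    qed
    then have "x \<in> U" using int by blast
    then show False using M(2) x in_closure_of_self[OF x(1)] by blast
  qed
qed

section \<open>\<open>WD\<close> of a well-filtered space\<close>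

lemma point_closures_subset_WD: "point_closures X \<subseteq> WD X"
  using point_closures_subset_RD RD_subset_WD by blast

text \<open>A closed set is its own closure, so testing \<open>A\<close> against the identity map
  yields its generic point. \<open>WD_universal\<close> is used because the identity lands in a
  space over \<open>'a\<close>, not over \<open>'a set\<close>.\<close>

lemma WD_well_filtered:
  assumes "well_filtered_space X"
  shows "WD X = point_closures X"
proof
  show "WD X \<subseteq> point_closures X"
  proof
    fix A assume A: "A \<in> WD X"
    then have "closedin X A" by (simp add: WD_def)
    then show "A \<in> point_closures X"
      using WD_universal[OF A assms continuous_map_id]
      by (auto simp: point_closures_def closure_of_closedin)
  qed
qed (rule point_closures_subset_WD)

section \<open>Irreducibility of the members of \<open>WD\<close>\<close>

text \<open>A filtered family of subsets of a finite set has a least member, and this is its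
  intersection. This supplies the well-filtered test space for irreducibility.\<close>

lemma well_filtered_finite:
  assumes t0: "t0_space Y" and fin: "finite (topspace Y)"
  shows "well_filtered_space Y"
  unfolding well_filtered_space_def
proof (intro conjI allI impI t0)
  fix U \<K>
  assume h: "openin Y U \<and> filtered_family \<K> \<and> \<K> \<subseteq> compact_saturated_sets Y \<and> \<Inter>\<K> \<subseteq> U"
  have "\<K> \<subseteq> Pow (topspace Y)" using h by (auto dest: compact_saturated_setsD(3))
  then have "finite \<K>" using fin by (meson finite_Pow_iff finite_subset)
  moreover have "\<K> \<noteq> {}" using h by (auto simp: filtered_family_def)
  ultimately obtain K where K: "K \<in> \<K>" "\<And>L. L \<in> \<K> \<Longrightarrow> L \<subseteq> K \<Longrightarrow> K = L"
    using finite_has_minimal[of \<K>] by metis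
  have "K \<subseteq> L" if "L \<in> \<K>" for L
    using h K that unfolding filtered_family_def by (metis Int_subset_iff)
  then have "K \<subseteq> \<Inter>\<K>" by blast
  also have "\<Inter>\<K> \<subseteq> U" using h by simp
  finally show "\<exists>K\<in>\<K>. K \<subseteq> U" using K(1) by blast
qed

text \<open>Irreducibility is detected by the map \<open>(\<chi>\<^sub>U, \<chi>\<^sub>V)\<close> into the square of the Sierpinski space.\<close>

lemma WD_irreducible:
  assumes A: "A \<in> WD X" and U: "openin X U" "A \<inter> U \<noteq> {}" and V: "openin X V" "A \<inter> V \<noteq> {}"
  shows "A \<inter> (U \<inter> V) \<noteq> {}"
proof -
  \<comment> \<open>The generator \<open>UNIV\<close> is what puts the point
    \<open>(False, False)\<close> into the space.\<close>
  define Y where "Y = topology_generated_by {UNIV, {p :: bool \<times> bool. fst p}, {p. snd p}}"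
  have o: "openin Y UNIV" "openin Y {p. fst p}" "openin Y {p. snd p}"
    unfolding Y_def by (auto intro!: topology_generated_by_Basis)
  have top: "topspace Y = UNIV" using o(1) openin_subset by blast
  have "t0_space Y"
    unfolding t0_space_def
  proof (intro ballI impI)
    fix p q :: "bool \<times> bool" assume "p \<noteq> q"
    then consider "fst p \<noteq> fst q" | "snd p \<noteq> snd q" by (auto simp: prod_eq_iff)
    then show "\<exists>U. openin Y U \<and> (p \<notin> U \<longleftrightarrow> q \<in> U)"
      by cases (use o in blast)+
  qed
  then have wf: "well_filtered_space Y" by (rule well_filtered_finite) simp
  define f where "f x = (x \<in> U, x \<in> V)" for x
  have AX: "A \<subseteq> topspace X" using A by (auto simp: WD_def dest: closedin_subset)
  have "continuous_map X Y f"
    unfolding Y_def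
  proof (rule continuous_on_generated_topo)
    have "f -` {p. fst p} \<inter> topspace X = U" "f -` {p. snd p} \<inter> topspace X = V"
      using openin_subset[OF U(1)] openin_subset[OF V(1)] by (auto simp: f_def)
    then show "openin X (f -` W \<inter> topspace X)" if "W \<in> {UNIV, {p. fst p}, {p. snd p}}" for W
      using that U(1) V(1) by auto
  qed auto
  then obtain y where y: "Y closure_of (f ` A) = Y closure_of {y}"
    using WD_universal[OF A wf] by blast
  \<comment> \<open>Every open set that meets \<open>f\<close>
    A\<open>contains\<close>y\<open>, as\<close>f \<open>A\<close> lies in the closure of
    \<open>y\<close>.\<close>
  have imp: "y \<in> W" if "openin Y W" "a \<in> A" "f a \<in> W" for W a
  proof -
    have "f a \<in> Y closure_of {y}" unfolding y[symmetric]
      using that(2) top by (auto simp: in_closure_of)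
    then show ?thesis using that by (auto simp: in_closure_of)
  qed
  let ?T = "{p :: bool \<times> bool. fst p} \<inter> {p. snd p}"
  have "y \<in> ?T"
    using U(2) V(2) imp[OF o(2)] imp[OF o(3)] by (auto simp: f_def)
  moreover have "y \<in> Y closure_of (f ` A)" unfolding y using top by (simp add: in_closure_of_self)
  moreover have "openin Y ?T" using o by (intro openin_Int)
  ultimately have "\<exists>z. z \<in> f ` A \<and> z \<in> ?T" by (simp only: in_closure_of)
  then obtain a where "a \<in> A" "f a \<in> ?T" by auto
  then show ?thesis by (auto simp: f_def)
qed

section \<open>The topology of the reflection\<close>

text \<open>Diamonds commute with unions, and by irreducibility of the members of
  \<open>WD X\<close> also with binary intersections, so the generating family is already a
  topology.\<close>

lemma openin_wf_reflection:
  "openin (wf_reflection X) W \<longleftrightarrow> (\<exists>U. openin X U \<and> W = WD_diamond X U)"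
proof
  assume "openin (wf_reflection X) W"
  then have "generate_topology_on {WD_diamond X U |U. openin X U} W"
    by (simp add: wf_reflection_def openin_topology_generated_by_iff)
  then show "\<exists>U. openin X U \<and> W = WD_diamond X U"
  proof induction
    case Empty
    show ?case by (intro exI[of _ "{}"]) (auto simp: WD_diamond_def)
  next
    case (Int a b)
    then obtain U V where UV: "openin X U" "a = WD_diamond X U" "openin X V" "b = WD_diamond X V"
      by blast
    then have "a \<inter> b = WD_diamond X (U \<inter> V)"
      using WD_irreducible[of _ X U V] by (auto simp: WD_diamond_def)
    then show ?case using UV by (intro exI[of _ "U \<inter> V"]) (auto intro: openin_Int)
  next
    case (UN \<W>)
    then obtain u where u: "\<And>w. w \<in> \<W> \<Longrightarrow> openin X (u w) \<and> w = WD_diamond X (u w)" by metis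
    have "\<Union>\<W> = WD_diamond X (\<Union>(u ` \<W>))"
    proof -
      have "\<Union>\<W> = (\<Union>w\<in>\<W>. WD_diamond X (u w))" using u by auto
      then show ?thesis by (auto simp: WD_diamond_def)
    qed
    moreover have "openin X (\<Union>(u ` \<W>))" using u by blast
    ultimately show ?case by (intro exI conjI)
  next
    case (Basis s)
    then show ?case by blast
  qed
next
  assume "\<exists>U. openin X U \<and> W = WD_diamond X U"
  then show "openin (wf_reflection X) W"
    unfolding wf_reflection_def by (auto intro: topology_generated_by_Basis)
qed

lemma closedin_wf_reflection:
  "closedin (wf_reflection X) \<C> \<longleftrightarrow> (\<exists>C. closedin X C \<and> \<C> = {A \<in> WD X. A \<subseteq> C})"
proof -
  have sub: "A \<subseteq> topspace X" if "A \<in> WD X" for A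
    using that by (auto simp: WD_def dest: closedin_subset)
  have box: "WD X - WD_diamond X U = {A \<in> WD X. A \<subseteq> topspace X - U}" for U
    using sub by (auto simp: WD_diamond_def)
  show ?thesis
  proof
    assume "closedin (wf_reflection X) \<C>"
    then obtain U where "openin X U" "\<C> \<subseteq> WD X" "WD X - \<C> = WD_diamond X U"
      unfolding closedin_def topspace_wf_reflection openin_wf_reflection by blast
    then have "closedin X (topspace X - U)" "\<C> = {A \<in> WD X. A \<subseteq> topspace X - U}"
      using box[of U] by auto
    then show "\<exists>C. closedin X C \<and> \<C> = {A \<in> WD X. A \<subseteq> C}" by blast
  next
    assume "\<exists>C. closedin X C \<and> \<C> = {A \<in> WD X. A \<subseteq> C}"
    then obtain C where C: "closedin X C" "\<C> = {A \<in> WD X. A \<subseteq> C}" by blast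
    have "WD X - \<C> = WD_diamond X (topspace X - C)"
      using sub by (auto simp: C(2) WD_diamond_def)
    then show "closedin (wf_reflection X) \<C>"
      unfolding closedin_def topspace_wf_reflection openin_wf_reflection using C by auto
  qed
qed

text \<open>Diamonds are upward closed under inclusion, so the specialization order of the
  reflection is inclusion; T0 then amounts to antisymmetry.\<close>

lemma closure_of_sing_wf_reflection:
  assumes A: "A \<in> WD X"
  shows "wf_reflection X closure_of {A} = {B \<in> WD X. B \<subseteq> A}"
proof (rule subset_antisym)
  have "closedin X A" using A by (simp add: WD_def)
  then have "closedin (wf_reflection X) {B \<in> WD X. B \<subseteq> A}"
    unfolding closedin_wf_reflection by blast
  then show "wf_reflection X closure_of {A} \<subseteq> {B \<in> WD X. B \<subseteq> A}"
    using A by (intro closure_of_sing_subset) auto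
  have "A \<in> WD_diamond X U" if "B \<subseteq> A" "B \<in> WD_diamond X U" for B U
    using that A unfolding WD_diamond_def by blast
  then show "{B \<in> WD X. B \<subseteq> A} \<subseteq> wf_reflection X closure_of {A}"
    by (auto simp: in_closure_of topspace_wf_reflection openin_wf_reflection)
qed

lemma t0_space_wf_reflection: "t0_space (wf_reflection X)"
  unfolding t0_space_closure_of_sing topspace_wf_reflection
  by (auto simp: closure_of_sing_wf_reflection)

section \<open>Extension of maps and well-filteredness of the reflection\<close>

lemma wf_reflection_extension:
  assumes wf: "well_filtered_space Y" and f: "continuous_map X Y f"
  obtains g where "continuous_map (wf_reflection X) Y g"
    "\<And>A. A \<in> WD X \<Longrightarrow> Y closure_of (f ` A) = Y closure_of {g A}"
proof -
  obtain g where g: "\<And>A. A \<in> WD X \<Longrightarrow> g A \<in> topspace Y"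
    "\<And>A. A \<in> WD X \<Longrightarrow> Y closure_of (f ` A) = Y closure_of {g A}"
    using WD_universal[OF _ wf f] by metis
  have fX: "f x \<in> topspace Y" if "x \<in> topspace X" for x
    using that f by (auto simp: continuous_map_def)
  have sub: "A \<subseteq> topspace X" if "A \<in> WD X" for A
    using that by (auto simp: WD_def dest: closedin_subset)
  have iff: "g A \<in> V \<longleftrightarrow> A \<inter> {x \<in> topspace X. f x \<in> V} \<noteq> {}"
    if A: "A \<in> WD X" and V: "openin Y V" for A V
  proof -
    have "g A \<in> V \<longleftrightarrow> Y closure_of {g A} \<inter> V \<noteq> {}"
      using openin_Int_closure_of_eq_empty[OF V, of "{g A}"] by auto
    also have "\<dots> \<longleftrightarrow> f ` A \<inter> V \<noteq> {}"
      using openin_Int_closure_of_eq_empty[OF V, of "f ` A"] g(2)[OF A] by auto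
    finally show ?thesis using sub[OF A] by auto
  qed
  have "continuous_map (wf_reflection X) Y g"
    unfolding continuous_map_def topspace_wf_reflection
  proof (intro conjI allI impI)
    show "g \<in> WD X \<rightarrow> topspace Y" using g(1) by auto
    fix V assume V: "openin Y V"
    have "{A \<in> WD X. g A \<in> V} = WD_diamond X {x \<in> topspace X. f x \<in> V}"
      using iff[OF _ V] by (auto simp: WD_diamond_def)
    moreover have "openin X {x \<in> topspace X. f x \<in> V}"
      by (rule openin_continuous_map_preimage[OF f V])
    ultimately show "openin (wf_reflection X) {A \<in> WD X. g A \<in> V}"
      unfolding openin_wf_reflection by blast
  qed
  then show ?thesis using g(2) that by blast
qed

theorem well_filtered_wf_reflection: "well_filtered_space (wf_reflection X)"
proof (rule well_filtered_if_RD_subset[OF t0_space_wf_reflection])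
  show "RD (wf_reflection X) \<subseteq> point_closures (wf_reflection X)"
  proof
    fix \<A> assume RD: "\<A> \<in> RD (wf_reflection X)"
    then have "closedin (wf_reflection X) \<A>" by (simp add: RD_def)
    then obtain D where D: "closedin X D" "\<A> = {A \<in> WD X. A \<subseteq> D}"
      unfolding closedin_wf_reflection by blast
    define C where "C = X closure_of \<Union>\<A>"
    have AX: "\<Union>\<A> \<subseteq> topspace X" using D closedin_subset by blast
    have "C \<subseteq> D" unfolding C_def using D by (intro closure_of_minimal) auto
    then have \<A>: "\<A> = {A \<in> WD X. A \<subseteq> C}"
      using closure_of_subset[OF AX] by (auto simp: D(2) C_def)
    have "\<exists>!y. y \<in> topspace Y \<and> Y closure_of (f ` C) = Y closure_of {y}"
      if wf: "well_filtered_space Y" and f: "continuous_map X Y f" for Y :: "'a set topology" and f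
    proof -
      obtain g where g: "continuous_map (wf_reflection X) Y g"
        and gf: "\<And>A. A \<in> WD X \<Longrightarrow> Y closure_of (f ` A) = Y closure_of {g A}"
        using wf_reflection_extension[OF wf f] by blast
      \<comment> \<open>Since \<open>\<A>\<close> is a Rudin set of the reflection, its image under
        the extension \<open>g\<close> has a generic point. What remains is that \<open>g\<close>
        \<A>\<open>and\<close>f \<open>C\<close> have the same closure.\<close>
      obtain y where y: "y \<in> topspace Y" "Y closure_of (g ` \<A>) = Y closure_of {y}"
        using RD_image_closure[OF RD wf g] by blast
      have gA: "g ` \<A> \<subseteq> topspace Y"
        using g by (auto simp: D(2) continuous_map_def topspace_wf_reflection)
      have fC: "f ` C \<subseteq> topspace Y"
        using f closure_of_subset_topspace[of X] by (auto simp: C_def continuous_map_def)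
      have "Y closure_of (f ` C) \<subseteq> Y closure_of (g ` \<A>)"
      proof -
        have "f ` A \<subseteq> Y closure_of (g ` \<A>)" if A: "A \<in> \<A>" for A
        proof -
          have "A \<subseteq> topspace X" using A AX by blast
          then have "f ` A \<subseteq> topspace Y" using f by (auto simp: continuous_map_def)
          then have "f ` A \<subseteq> Y closure_of (f ` A)" by (rule closure_of_subset)
          also have "\<dots> = Y closure_of {g A}" using A gf by (auto simp: D(2))
          also have "\<dots> \<subseteq> Y closure_of (g ` \<A>)" using A by (intro closure_of_mono) auto
          finally show ?thesis .
        qed
        then have "f ` (\<Union>\<A>) \<subseteq> Y closure_of (g ` \<A>)" by blast
        then have "Y closure_of (f ` \<Union>\<A>) \<subseteq> Y closure_of (g ` \<A>)" by (simp add: closure_of_minimal)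
        \<comment> \<open>Continuity carries the inclusion from the union to its closure
          \<open>C\<close>.\<close>
        then have "f ` C \<subseteq> Y closure_of (g ` \<A>)"
          using continuous_map_image_closure_subset[OF f, of "\<Union>\<A>"] by (auto simp: C_def)
        then show ?thesis by (simp add: closure_of_minimal)
      qed
      moreover have "Y closure_of (g ` \<A>) \<subseteq> Y closure_of (f ` C)"
      proof -
        have "g A \<in> Y closure_of (f ` C)" if A: "A \<in> \<A>" for A
        proof -
          have "g A \<in> Y closure_of (f ` A)"
            using A gf gA in_closure_of_self[of "g A" Y] by (auto simp: D(2))
          also have "\<dots> \<subseteq> Y closure_of (f ` C)"
            using A by (intro closure_of_mono) (auto simp: \<A>)
          finally show ?thesis .
        qed
        then show ?thesis by (simp add: closure_of_minimal image_subset_iff)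
      qed
      ultimately have "Y closure_of (f ` C) = Y closure_of {y}" using y(2) by simp
      then show ?thesis
        using y(1) wf t0_space_closure_of_sing_inj[of Y] unfolding well_filtered_space_def by metis
    qed
    then have C: "C \<in> WD X" by (simp add: WD_def C_def)
    then have "\<A> = wf_reflection X closure_of {C}"
      by (simp add: \<A> closure_of_sing_wf_reflection)
    then show "\<A> \<in> point_closures (wf_reflection X)"
      using C by (auto simp: point_closures_def topspace_wf_reflection)
  qed
qed

section \<open>Homeomorphism with the reflection\<close>

text \<open>The Rudin criterion avoids transporting filtered families: for \<open>A\<close> in
  \<open>RD X\<close>, the image in \<open>Z\<close> has a generic point \<open>z\<close>, and the
  inverse homeomorphism makes \<open>g z\<close> generic for \<open>A\<close>.\<close>

lemma well_filtered_homeomorphic: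
  assumes hom: "X homeomorphic_space Z" and wf: "well_filtered_space Z"
  shows "well_filtered_space X"
proof (rule well_filtered_if_RD_subset)
  have "t0_space Z" using wf by (simp add: well_filtered_space_def)
  then show "t0_space X" using homeomorphic_t0_space[OF hom] by simp
  obtain h g where hg: "homeomorphic_maps X Z h g" using hom by (auto simp: homeomorphic_space_def)
  have h: "continuous_map X Z h" and g: "continuous_map Z X g"
    and gh: "\<And>x. x \<in> topspace X \<Longrightarrow> g (h x) = x" and gm: "homeomorphic_map Z X g"
    using hg homeomorphic_maps_sym[of X Z h g] homeomorphic_maps_map[of Z X g h]
    by (auto simp: homeomorphic_maps_def)
  show "RD X \<subseteq> point_closures X"
  proof
    fix A assume A: "A \<in> RD X"
    then have cA: "closedin X A" by (simp add: RD_def)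
    have AX: "A \<subseteq> topspace X" using cA by (rule closedin_subset)
    have hA: "h ` A \<subseteq> topspace Z" using h AX by (auto simp: continuous_map_def)
    obtain z where z: "z \<in> topspace Z" "Z closure_of (h ` A) = Z closure_of {z}"
      using RD_image_closure[OF A wf h] by blast
    have "g ` h ` A = A" using gh AX by force
    then have "A = X closure_of (g ` h ` A)" using cA by (simp add: closure_of_closedin)
    also have "\<dots> = X closure_of {g z}"
      using homeomorphic_map_closure_of[OF gm hA] homeomorphic_map_closure_of[OF gm, of "{z}"] z
      by simp
    finally show "A \<in> point_closures X"
      using z(1) g by (auto simp: point_closures_def continuous_map_def)
  qed
qed

text \<open>The homeomorphism is the canonical map from a point to its closure: T0 makes it
  injective, the assumption on \<open>WD X\<close> makes it surjective.\<close>

lemma homeomorphic_space_wf_reflection: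
  assumes t0: "t0_space X" and WD: "WD X = point_closures X"
  shows "X homeomorphic_space wf_reflection X"
proof -
  let ?c = "\<lambda>x. X closure_of {x}"
  \<comment> \<open>An open set meets the closure of \<open>x\<close> exactly if it contains
    \<open>x\<close>; thus \<open>U\<close> corresponds to its diamond, which gives continuity and
    openness.\<close>
  have diamond: "?c x \<in> WD_diamond X U \<longleftrightarrow> x \<in> U" if "x \<in> topspace X" "openin X U" for x U
    using openin_Int_closure_of_eq_empty[OF that(2), of "{x}"] that(1)
    by (auto simp: WD_diamond_def WD point_closures_def)
  have surj: "?c ` topspace X = WD X" by (auto simp: WD point_closures_def)
  have "homeomorphic_map X (wf_reflection X) ?c"
    unfolding homeomorphic_eq_everything_map
  proof (intro conjI)
    show "continuous_map X (wf_reflection X) ?c"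
      unfolding continuous_map_def topspace_wf_reflection openin_wf_reflection
    proof (intro conjI allI impI)
      show "?c \<in> topspace X \<rightarrow> WD X" using surj by auto
      fix W assume "\<exists>U. openin X U \<and> W = WD_diamond X U"
      then obtain U where U: "openin X U" "W = WD_diamond X U" by blast
      then have "{x \<in> topspace X. ?c x \<in> W} = U"
        using diamond openin_subset[OF U(1)] by auto
      then show "openin X {x \<in> topspace X. ?c x \<in> W}" using U by simp
    qed
    show op: "open_map X (wf_reflection X) ?c"
      unfolding open_map_def openin_wf_reflection
    proof (intro allI impI)
      fix U assume U: "openin X U"
      have "?c ` U = WD_diamond X U"
      proof
        show "?c ` U \<subseteq> WD_diamond X U" using diamond[OF _ U] openin_subset[OF U] by auto
        show "WD_diamond X U \<subseteq> ?c ` U"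
        proof
          fix A assume A: "A \<in> WD_diamond X U"
          then obtain x where "x \<in> topspace X" "A = ?c x"
            using surj by (auto simp: WD_diamond_def)
          then show "A \<in> ?c ` U" using diamond[OF _ U] A by auto
        qed
      qed
      then show "\<exists>V. openin X V \<and> ?c ` U = WD_diamond X V" using U by blast
    qed
    show "?c ` topspace X = topspace (wf_reflection X)" by (simp add: surj topspace_wf_reflection)
    show inj: "inj_on ?c (topspace X)"
      by (intro inj_onI t0_space_closure_of_sing_inj[OF t0])
    show "closed_map X (wf_reflection X) ?c"
      using bijective_open_imp_closed_map[OF op] inj surj by (simp add: topspace_wf_reflection)
  qed
  then show ?thesis by (rule homeomorphic_map_imp_homeomorphic_space)
qed

theorem corollary7p11:
  fixes X :: "'a topology"
  assumes "t0_space X"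
  shows "(well_filtered_space X \<longleftrightarrow> RD X = point_closures X)
       \<and> (well_filtered_space X \<longleftrightarrow> WD X = point_closures X)
       \<and> (well_filtered_space X \<longleftrightarrow>
            (\<forall>A\<in>WD X. \<exists>!x. x \<in> topspace X \<and> A = X closure_of {x}))
       \<and> (well_filtered_space X \<longleftrightarrow> X homeomorphic_space wf_reflection X)"
proof -
  \<comment> \<open>As point closures lie in \<open>RD X\<close> and \<open>RD X\<close> lies in
    \<open>WD X\<close>, both equalities reduce to inclusions into the point closures, and the one
    for \<open>WD X\<close> implies the one for \<open>RD X\<close>.\<close>
  have RD: "well_filtered_space X" if "RD X \<subseteq> point_closures X"
    by (rule well_filtered_if_RD_subset[OF assms that])
  have WD: "well_filtered_space X" if "WD X \<subseteq> point_closures X"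
    using RD RD_subset_WD that by blast
  have "A \<in> point_closures X \<longleftrightarrow> (\<exists>!x. x \<in> topspace X \<and> A = X closure_of {x})" for A
    using t0_space_closure_of_sing_inj[OF assms] by (auto simp: point_closures_def)
  then have "WD X \<subseteq> point_closures X \<longleftrightarrow>
      (\<forall>A\<in>WD X. \<exists>!x. x \<in> topspace X \<and> A = X closure_of {x})"
    by (simp add: subset_iff Ball_def)
  moreover have "well_filtered_space X \<longleftrightarrow> WD X \<subseteq> point_closures X"
    using WD WD_well_filtered by blast
  moreover have "WD X = point_closures X \<longleftrightarrow> WD X \<subseteq> point_closures X"
    using point_closures_subset_WD by blast
  moreover have "well_filtered_space X \<longleftrightarrow> RD X = point_closures X"
    using RD WD_well_filtered RD_subset_WD point_closures_subset_RD by blast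
  \<comment> \<open>Backward, \<open>X\<close> inherits well-filteredness from its reflection, which
    always has it.\<close>
  moreover have "well_filtered_space X \<longleftrightarrow> X homeomorphic_space wf_reflection X"
    using homeomorphic_space_wf_reflection[OF assms] WD_well_filtered
      well_filtered_homeomorphic[OF _ well_filtered_wf_reflection] by blast
  ultimately show ?thesis by metis
qed

end
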